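(* Let $\Sigma\subset\mathbb P^4$ be a smooth rational normal cubic scroll. Then there exist lines $\ell\subset\mathbb P^4$ with $\ell\cap\Sigma=\emptyset$ such that the branch curve of the projection $\pi:\Sigma\to\mathbb P^2$ from $\ell$ is the union of an irreducible cuspidal cubic and the tangent line to it at its unique flex.
   Context: The projection from a line disjoint from $\Sigma$ is a finite degree $3$ morphism $\Sigma\to\mathbb P^2$; its branch curve is its branch divisor. *)

theory Defs
  imports "HOL-Analysis.Analysis"
begin

text \<open>Projective space P^n over the complex numbers is modelled by nonzero vectors
of complex^(n+1) up to nonzero scalars; a projective variety is represented by
its affine cone minus the origin (a set of nonzero vectors closed under nonzero scaling).\<close>

text \<open>The standard smooth rational normal cubic scroll S(1,2) in P^4:
points [s x : t x : s^2 y : s t y : t^2 y], (s:t), (x:y) in P^1.\<close>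
definition std_cubic_scroll :: "(complex^5) set" where
  "std_cubic_scroll = {v. \<exists>s t x y. (s, t) \<noteq> (0, 0) \<and> (x, y) \<noteq> (0, 0) \<and>
      v $ 0 = s * x \<and> v $ 1 = t * x \<and> v $ 2 = s^2 * y \<and> v $ 3 = s * t * y \<and> v $ 4 = t^2 * y}"

text \<open>A smooth rational normal cubic scroll in P^4: a projective transform of the standard one.\<close>
definition rational_normal_cubic_scroll :: "(complex^5) set \<Rightarrow> bool" where
  "rational_normal_cubic_scroll S \<longleftrightarrow>
     (\<exists>M :: complex^5^5. invertible M \<and> S = (\<lambda>v. M *v v) ` std_cubic_scroll)"

text \<open>A line in P^4: (the cone over it is) a 2-dimensional complex linear subspace of complex^5.\<close>
definition proj_line :: "(complex^5) set \<Rightarrow> bool" where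
  "proj_line L \<longleftrightarrow> (\<exists>u w. (\<forall>a b. a *s u + b *s w = 0 \<longrightarrow> a = 0 \<and> b = 0) \<and>
       L = {a *s u + b *s w | a b. True})"

text \<open>The projective point (class) of a nonzero vector.\<close>
definition proj_point :: "'a::field^'n \<Rightarrow> ('a^'n) set" where
  "proj_point v = {c *s v | c. c \<noteq> 0}"

text \<open>Projective points of S over the point [q] of P^2 under the linear projection A.\<close>
definition proj_fiber :: "(complex^5) set \<Rightarrow> complex^5^3 \<Rightarrow> complex^3 \<Rightarrow> (complex^5) set set" where
  "proj_fiber S A q = proj_point ` {v \<in> S. \<exists>c. A *v v = c *s q}"

text \<open>Branch locus (cone over it) of the finite degree 3 morphism S \<rightarrow> P^2:
points of P^2 over which the fiber has fewer than 3 distinct points.\<close>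
definition branch_locus :: "(complex^5) set \<Rightarrow> complex^5^3 \<Rightarrow> (complex^3) set" where
  "branch_locus S A = {q. q \<noteq> 0 \<and> card (proj_fiber S A q) < 3}"

text \<open>Normal form: the irreducible cuspidal cubic y^2 z = x^3 together with its tangent
line z = 0 at its unique flex [0:1:0].\<close>
definition cusp_cubic_and_flex_tangent :: "(complex^3) set" where
  "cusp_cubic_and_flex_tangent =
     {w. w \<noteq> 0 \<and> ((w $ 1)^2 * (w $ 2) - (w $ 0)^3) * (w $ 2) = 0}"

end

theory Submission
  imports Defs "HOL-Computational_Algebra.Fundamental_Theorem_Algebra"
begin

(* Projecting from a line disjoint from the scroll and the branch locus of the projection are
   both compatible with projective transformations, so it suffices to treat the standard scroll
   S(1,2) of points (s x, t x, s^2 y, s t y, t^2 y). Project it from the line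
   v0 = v4 = v1 + v2 = 0, i.e. v |-> (-v4, v1 + v2, -v0). Over a point q with q0 <> 0 the fibre
   consists of the points with (s : t) = (z : 1), z a root of q0 z^3 + q1 z + q2, and distinct
   roots give distinct points; over the line q0 = 0 the fibre lies on the union of the ruling
   t = 0 and the directrix y = 0 and so has at most two points. Hence the branch curve is
   q0 (4 q1^3 + 27 q0 q2^2) = 0, which the coordinates (x, y, z) = (-q1, 3 q2, 3/4 q0) turn
   into the cuspidal cubic y^2 z = x^3 together with its flex tangent z = 0. *)

lemma UNIV_5_eq: "(UNIV :: 5 set) = {0, 1, 2, 3, 4}"
proof -
  have "x = 0 \<or> x = 1 \<or> x = 2 \<or> x = 3 \<or> x = 4" for x :: 5
  proof (induct x)
    case (of_int z)
    then have "z = 0 \<or> z = 1 \<or> z = 2 \<or> z = 3 \<or> z = 4" by fastforce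
    then show ?case by auto
  qed
  then show ?thesis by auto
qed

lemma UNIV_3_eq: "(UNIV :: 3 set) = {0, 1, 2}"
proof -
  have "x = 0 \<or> x = 1 \<or> x = 2" for x :: 3
  proof (induct x)
    case (of_int z)
    then have "z = 0 \<or> z = 1 \<or> z = 2" by fastforce
    then show ?case by auto
  qed
  then show ?thesis by auto
qed

lemma forall_5_eq: "(\<forall>i::5. P i) \<longleftrightarrow> P 0 \<and> P 1 \<and> P 2 \<and> P 3 \<and> P 4"
proof -
  have "(\<forall>i::5. P i) \<longleftrightarrow> (\<forall>i \<in> UNIV. P i)" by simp
  then show ?thesis unfolding UNIV_5_eq by simp
qed

lemma forall_3_eq: "(\<forall>i::3. P i) \<longleftrightarrow> P 0 \<and> P 1 \<and> P 2"
proof -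
  have "(\<forall>i::3. P i) \<longleftrightarrow> (\<forall>i \<in> UNIV. P i)" by simp
  then show ?thesis unfolding UNIV_3_eq by simp
qed

lemma vec_eq_5_iff:
  fixes u w :: "'a^5"
  shows "u = w \<longleftrightarrow> u$0 = w$0 \<and> u$1 = w$1 \<and> u$2 = w$2 \<and> u$3 = w$3 \<and> u$4 = w$4"
  unfolding vec_eq_iff forall_5_eq ..

lemma vec_eq_3_iff:
  fixes u w :: "'a^3"
  shows "u = w \<longleftrightarrow> u$0 = w$0 \<and> u$1 = w$1 \<and> u$2 = w$2"
  unfolding vec_eq_iff forall_3_eq ..

lemma sum_UNIV_5: "sum f (UNIV :: 5 set) = f 0 + f 1 + f 2 + f 3 + f 4"
  unfolding UNIV_5_eq by (simp add: ac_simps)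

lemma sum_UNIV_3: "sum f (UNIV :: 3 set) = f 0 + f 1 + f 2"
  unfolding UNIV_3_eq by (simp add: ac_simps)

lemma matrix_inv:
  fixes M :: "'a::semiring_1^'n^'m"
  assumes "invertible M"
  shows matrix_inv_right: "M ** matrix_inv M = mat 1"
    and matrix_inv_left: "matrix_inv M ** M = mat 1"
proof -
  obtain M' where "M ** M' = mat 1 \<and> M' ** M = mat 1"
    using assms unfolding invertible_def by blast
  then have "M ** matrix_inv M = mat 1 \<and> matrix_inv M ** M = mat 1"
    unfolding matrix_inv_def by (rule someI)
  then show "M ** matrix_inv M = mat 1" "matrix_inv M ** M = mat 1" by simp_all
qed

lemma matrix_inv_cancel:
  fixes M :: "'a::comm_semiring_1^'n^'n"
  assumes "invertible M"
  shows matrix_inv_mult_cancel_left: "matrix_inv M *v (M *v v) = v"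
    and matrix_inv_mult_cancel_right: "M *v (matrix_inv M *v v) = v"
  by (simp_all add: matrix_vector_mul_assoc matrix_inv_left matrix_inv_right assms)

lemma proj_point_smult:
  fixes w :: "'a::field^'n"
  assumes "c \<noteq> 0"
  shows "proj_point (c *s w) = proj_point w"
  unfolding proj_point_def
proof safe
  fix d :: 'a assume "d \<noteq> 0"
  then show "\<exists>e. d *s (c *s w) = e *s w \<and> e \<noteq> 0"
    using assms by (intro exI[of _ "d * c"]) auto
  show "\<exists>e. d *s w = e *s (c *s w) \<and> e \<noteq> 0"
    using assms \<open>d \<noteq> 0\<close> by (intro exI[of _ "d / c"]) auto
qed

lemma proj_point_eq_imp_smult:
  assumes "proj_point u = proj_point w"
  shows "\<exists>k. u = k *s w"
proof -
  have "u \<in> proj_point u" unfolding proj_point_def by (intro CollectI exI[of _ 1]) auto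
  then show ?thesis using assms unfolding proj_point_def by auto
qed

lemma proj_point_matrix_vector_mult:
  fixes M :: "'a::field^'n^'m"
  shows "proj_point (M *v w) = (*v) M ` proj_point w"
  unfolding proj_point_def by (force simp: vector_scalar_commute)

lemma proj_line_image:
  assumes "invertible M" and "proj_line L"
  shows "proj_line ((*v) M ` L)"
proof -
  obtain u w where indep: "\<forall>a b. a *s u + b *s w = 0 \<longrightarrow> a = 0 \<and> b = 0"
    and L: "L = {a *s u + b *s w | a b. True}"
    using assms(2) unfolding proj_line_def by blast
  have lin: "M *v (a *s u + b *s w) = a *s (M *v u) + b *s (M *v w)" for a b
    by (simp add: matrix_vector_right_distrib vector_scalar_commute)
  have "a = 0 \<and> b = 0" if "a *s (M *v u) + b *s (M *v w) = 0" for a b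
  proof -
    have "M *v (a *s u + b *s w) = M *v 0" using that lin by simp
    with inj_matrix_vector_mult[OF assms(1)] have "a *s u + b *s w = 0" by (rule injD)
    then show ?thesis using indep by blast
  qed
  moreover have "(*v) M ` L = {a *s (M *v u) + b *s (M *v w) | a b. True}"
    unfolding L lin[symmetric] by blast
  ultimately show ?thesis unfolding proj_line_def by blast
qed

lemma kernel_mult_matrix_inv:
  fixes M :: "'a::field^'n^'n"
  assumes "invertible M"
  shows "{v. (A ** matrix_inv M) *v v = 0} = (*v) M ` {v. A *v v = 0}"
proof (intro set_eqI iffI)
  fix v assume "v \<in> {v. (A ** matrix_inv M) *v v = 0}"
  then have "matrix_inv M *v v \<in> {v. A *v v = 0}" by (simp add: matrix_vector_mul_assoc)
  then show "v \<in> (*v) M ` {v. A *v v = 0}"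
    using image_eqI matrix_inv_mult_cancel_right[OF assms] by metis
next
  fix v assume "v \<in> (*v) M ` {v. A *v v = 0}"
  then show "v \<in> {v. (A ** matrix_inv M) *v v = 0}"
    by (auto simp: matrix_vector_mul_assoc[symmetric] matrix_inv_mult_cancel_left[OF assms])
qed

lemma proj_fiber_image:
  assumes "invertible M"
  shows "proj_fiber ((*v) M ` S) (A ** matrix_inv M) q = (`) ((*v) M) ` proj_fiber S A q"
proof -
  have fiber: "{v \<in> (*v) M ` S. \<exists>c. (A ** matrix_inv M) *v v = c *s q}
      = (*v) M ` {v \<in> S. \<exists>c. A *v v = c *s q}"
    by (auto simp: matrix_vector_mul_assoc[symmetric] matrix_inv_mult_cancel_left[OF assms])
  show ?thesis
    unfolding proj_fiber_def fiber image_image proj_point_matrix_vector_mult ..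
qed

lemma branch_locus_image:
  assumes "invertible M"
  shows "branch_locus ((*v) M ` S) (A ** matrix_inv M) = branch_locus S A"
proof -
  have "inj ((`) ((*v) M))"
    using inj_matrix_vector_mult[OF assms] by (simp add: inj_def inj_image_eq_iff)
  then have "card (proj_fiber ((*v) M ` S) (A ** matrix_inv M) q) = card (proj_fiber S A q)" for q
    unfolding proj_fiber_image[OF assms] by (simp add: card_image inj_on_subset)
  then show ?thesis unfolding branch_locus_def by simp
qed

definition has_cusp_flex_branch_projection :: "(complex^5) set \<Rightarrow> bool" where
  "has_cusp_flex_branch_projection S \<longleftrightarrow>
     (\<exists>L. proj_line L \<and> L \<inter> S = {} \<and>
        (\<exists>A :: complex^5^3. {v. A *v v = 0} = L \<and>
           (\<exists>N :: complex^3^3. invertible N \<and>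
              branch_locus S A = {q. N *v q \<in> cusp_cubic_and_flex_tangent})))"

lemma has_cusp_flex_branch_projection_image:
  assumes "invertible M" and "has_cusp_flex_branch_projection S"
  shows "has_cusp_flex_branch_projection ((*v) M ` S)"
proof -
  obtain L A N where "proj_line L" "L \<inter> S = {}" "{v. A *v v = 0} = L" "invertible N"
    and branch: "branch_locus S A = {q. N *v q \<in> cusp_cubic_and_flex_tangent}"
    using assms(2) unfolding has_cusp_flex_branch_projection_def by blast
  have "(*v) M ` L \<inter> (*v) M ` S = {}"
    using \<open>L \<inter> S = {}\<close> inj_matrix_vector_mult[OF assms(1)] by (simp add: image_Int[symmetric])
  show ?thesis
    unfolding has_cusp_flex_branch_projection_def
  proof (intro exI conjI)
    show "proj_line ((*v) M ` L)" using proj_line_image[OF assms(1) \<open>proj_line L\<close>] .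
    show "{v. (A ** matrix_inv M) *v v = 0} = (*v) M ` L"
      using kernel_mult_matrix_inv[OF assms(1), of A] unfolding \<open>{v. A *v v = 0} = L\<close> .
    show "branch_locus ((*v) M ` S) (A ** matrix_inv M) = {q. N *v q \<in> cusp_cubic_and_flex_tangent}"
      using branch_locus_image[OF assms(1)] branch by simp
  qed fact+
qed

lemma depressed_cubic_splits:
  fixes p r :: complex
  obtains a b where "\<And>z. z^3 + p*z + r = (z - a) * (z - b) * (z + a + b)"
    and "4*p^3 + 27*r^2 = - (((a - b) * (2*a + b) * (a + 2*b))^2)"
proof -
  have "\<exists>z. poly [:r, p, 0, 1:] z = 0"
    by (rule fundamental_theorem_of_algebra_alt) auto
  then obtain a where root: "a^3 + p*a + r = 0"
    by (auto simp: algebra_simps power3_eq_cube)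
  \<comment> \<open>the two remaining roots are the roots of \<open>z^2 + a z + a^2 + p\<close>\<close>
  define b where "b = (csqrt (-3*a^2 - 4*p) - a) / 2"
  have p: "p = -(a^2) - a*b - b^2"
    unfolding b_def by (simp add: field_simps power2_eq_square) algebra
  have r: "r = a^2*b + a*b^2"
    using root p by (simp add: algebra_simps power2_eq_square power3_eq_cube)
  have "z^3 + p*z + r = (z - a) * (z - b) * (z + a + b)" for z
    unfolding p r by algebra
  moreover have "4*p^3 + 27*r^2 = - (((a - b) * (2*a + b) * (a + 2*b))^2)"
    unfolding p r by algebra
  ultimately show ?thesis by (rule that)
qed

lemma card_cubic_roots_less_3_iff:
  fixes a b c :: complex
  assumes "a \<noteq> 0"
  shows "card {z. a*z^3 + b*z + c = 0} < 3 \<longleftrightarrow> 4*b^3 + 27*a*c^2 = 0"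
proof -
  obtain \<alpha> \<beta> where split: "\<And>z. z^3 + (b/a)*z + c/a = (z - \<alpha>) * (z - \<beta>) * (z + \<alpha> + \<beta>)"
    and disc: "4*(b/a)^3 + 27*(c/a)^2 = - (((\<alpha> - \<beta>) * (2*\<alpha> + \<beta>) * (\<alpha> + 2*\<beta>))^2)"
    using depressed_cubic_splits[of "b/a" "c/a"] by blast
  have "a*z^3 + b*z + c = a * (z^3 + (b/a)*z + c/a)" for z
    using assms by (simp add: field_simps)
  then have "{z. a*z^3 + b*z + c = 0} = {\<alpha>, \<beta>, -\<alpha>-\<beta>}"
    using split assms by (auto simp: add_eq_0_iff)
  then have "card {z. a*z^3 + b*z + c = 0} < 3 \<longleftrightarrow> \<alpha> = \<beta> \<or> \<alpha> = -\<alpha>-\<beta> \<or> \<beta> = -\<alpha>-\<beta>"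
    by (auto simp: card_insert_if)
  also have "\<dots> \<longleftrightarrow> (\<alpha> - \<beta>) * (2*\<alpha> + \<beta>) * (\<alpha> + 2*\<beta>) = 0"
    unfolding mult_eq_0_iff by (auto simp: algebra_simps eq_neg_iff_add_eq_0)
  also have "\<dots> \<longleftrightarrow> 4*(b/a)^3 + 27*(c/a)^2 = 0"
    using disc by simp
  also have "\<dots> \<longleftrightarrow> 4*b^3 + 27*a*c^2 = 0"
  proof -
    have "a^3 * (4*(b/a)^3 + 27*(c/a)^2) = 4*b^3 + 27*a*c^2"
      using assms by (simp add: field_simps power3_eq_cube power2_eq_square)
    then show ?thesis using assms by (metis mult_eq_0_iff power_not_zero)
  qed
  finally show ?thesis .
qed

definition scroll_point :: "complex \<Rightarrow> complex \<Rightarrow> complex \<Rightarrow> complex \<Rightarrow> complex^5" where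
  "scroll_point s t x y = (\<chi> i. if i = 0 then s*x else if i = 1 then t*x
     else if i = 2 then s^2*y else if i = 3 then s*t*y else t^2*y)"

lemma scroll_point_nth [simp]:
  "scroll_point s t x y $ 0 = s*x" "scroll_point s t x y $ 1 = t*x"
  "scroll_point s t x y $ 2 = s^2*y" "scroll_point s t x y $ 3 = s*t*y"
  "scroll_point s t x y $ 4 = t^2*y"
  by (simp_all add: scroll_point_def)

lemma std_cubic_scroll_eq:
  "std_cubic_scroll = {scroll_point s t x y | s t x y. (s, t) \<noteq> (0, 0) \<and> (x, y) \<noteq> (0, 0)}"
  unfolding std_cubic_scroll_def vec_eq_5_iff by auto

definition std_projection :: "complex^5^3" where
  "std_projection = (\<chi> i j. if i = 0 \<and> j = 4 then -1 else if i = 1 \<and> (j = 1 \<or> j = 2) then 1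
     else if i = 2 \<and> j = 0 then -1 else 0)"

lemma std_projection_nth [simp]:
  "(std_projection *v v) $ 0 = - v$4" "(std_projection *v v) $ 1 = v$1 + v$2"
  "(std_projection *v v) $ 2 = - v$0"
  by (simp_all add: std_projection_def matrix_vector_mult_def sum_UNIV_5)

lemma std_projection_scroll_point_eq_iff:
  "std_projection *v scroll_point s t x y = c *s q \<longleftrightarrow>
     -(t^2*y) = c * q$0 \<and> t*x + s^2*y = c * q$1 \<and> -(s*x) = c * q$2"
  by (simp add: vec_eq_3_iff)

lemma std_projection_nonzero:
  assumes "v \<in> std_cubic_scroll"
  shows "std_projection *v v \<noteq> 0"
proof
  assume "std_projection *v v = 0"
  moreover obtain s t x y where "(s, t) \<noteq> (0, 0)" "(x, y) \<noteq> (0, 0)" "v = scroll_point s t x y"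
    using assms unfolding std_cubic_scroll_eq by blast
  ultimately show False
    using std_projection_scroll_point_eq_iff[of s t x y 0] by auto
qed

lemma proj_line_std_center: "proj_line {v. std_projection *v v = 0}"
  unfolding proj_line_def
proof (intro exI conjI)
  let ?u = "axis 3 1 :: complex^5" and ?w = "axis 1 1 - axis 2 1 :: complex^5"
  show "\<forall>a b. a *s ?u + b *s ?w = 0 \<longrightarrow> a = 0 \<and> b = 0"
    by (simp add: vec_eq_5_iff axis_def)
  show "{v. std_projection *v v = 0} = {a *s ?u + b *s ?w | a b. True}"
  proof (intro set_eqI iffI)
    fix v assume "v \<in> {v. std_projection *v v = 0}"
    then have "v = v$3 *s ?u + v$1 *s ?w"
      by (simp add: vec_eq_3_iff vec_eq_5_iff axis_def eq_neg_iff_add_eq_0 add.commute)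
    then show "v \<in> {a *s ?u + b *s ?w | a b. True}" by blast
  qed (auto simp: vec_eq_3_iff axis_def)
qed

lemma proj_fiber_std_memE:
  assumes "P \<in> proj_fiber std_cubic_scroll std_projection q"
  obtains s t x y c where "c \<noteq> 0" and "P = proj_point (scroll_point s t x y)"
    and "-(t^2*y) = c * q$0" "t*x + s^2*y = c * q$1" "-(s*x) = c * q$2"
proof -
  obtain v c where v: "v \<in> std_cubic_scroll" and proj: "std_projection *v v = c *s q"
    and P: "P = proj_point v"
    using assms unfolding proj_fiber_def by blast
  then obtain s t x y where v_eq: "v = scroll_point s t x y"
    unfolding std_cubic_scroll_eq by blast
  have "c \<noteq> 0" using std_projection_nonzero[OF v] proj by auto
  moreover have "-(t^2*y) = c * q$0 \<and> t*x + s^2*y = c * q$1 \<and> -(s*x) = c * q$2"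
    using proj unfolding v_eq std_projection_scroll_point_eq_iff .
  ultimately show ?thesis
    using that P unfolding v_eq by blast
qed

lemma proj_fiber_std_eq_cubic_roots:
  assumes q0: "q$0 \<noteq> 0"
  shows "proj_fiber std_cubic_scroll std_projection q =
    (\<lambda>z. proj_point (scroll_point z 1 (q$1 + z^2*q$0) (-q$0))) ` {z. q$0*z^3 + q$1*z + q$2 = 0}"
proof (intro set_eqI iffI)
  fix P assume "P \<in> proj_fiber std_cubic_scroll std_projection q"
  then obtain s t x y c where "c \<noteq> 0" and P: "P = proj_point (scroll_point s t x y)"
    and e: "-(t^2*y) = c * q$0" "t*x + s^2*y = c * q$1" "-(s*x) = c * q$2"
    by (rule proj_fiber_std_memE)
  have t: "t \<noteq> 0" using e(1) \<open>c \<noteq> 0\<close> q0 by auto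
  define z where "z = s/t"
  have s: "s = z*t" using t unfolding z_def by simp
  have x: "t*x = c*(q$1 + z^2*q$0)"
    using e unfolding s by algebra
  have "c*(q$0*z^3 + q$1*z + q$2) = 0"
    using e x unfolding s by algebra
  then have root: "q$0*z^3 + q$1*z + q$2 = 0" using \<open>c \<noteq> 0\<close> by simp
  have "scroll_point s t x y = c *s scroll_point z 1 (q$1 + z^2*q$0) (-q$0)"
    unfolding vec_eq_5_iff using e x unfolding s by simp algebra
  then have "P = proj_point (scroll_point z 1 (q$1 + z^2*q$0) (-q$0))"
    unfolding P by (simp add: proj_point_smult[OF \<open>c \<noteq> 0\<close>])
  with root show "P \<in> (\<lambda>z. proj_point (scroll_point z 1 (q$1 + z^2*q$0) (-q$0))) `
      {z. q$0*z^3 + q$1*z + q$2 = 0}"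
    by blast
next
  fix P assume "P \<in> (\<lambda>z. proj_point (scroll_point z 1 (q$1 + z^2*q$0) (-q$0))) `
      {z. q$0*z^3 + q$1*z + q$2 = 0}"
  then obtain z where root: "q$0*z^3 + q$1*z + q$2 = 0"
    and P: "P = proj_point (scroll_point z 1 (q$1 + z^2*q$0) (-q$0))" by blast
  have "scroll_point z 1 (q$1 + z^2*q$0) (-q$0) \<in> std_cubic_scroll"
    unfolding std_cubic_scroll_eq using q0 by force
  moreover have "std_projection *v scroll_point z 1 (q$1 + z^2*q$0) (-q$0) = 1 *s q"
    unfolding std_projection_scroll_point_eq_iff using root by simp algebra
  ultimately show "P \<in> proj_fiber std_cubic_scroll std_projection q"
    unfolding proj_fiber_def using P by blast
qed

lemma card_proj_fiber_std_le_2: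
  assumes "q$0 = 0"
  shows "card (proj_fiber std_cubic_scroll std_projection q) \<le> 2"
proof -
  let ?P\<^sub>1 = "proj_point (scroll_point 1 0 (-q$2) (q$1))"
    and ?P\<^sub>2 = "proj_point (scroll_point (-q$2) (q$1) 1 0)"
  have "proj_fiber std_cubic_scroll std_projection q \<subseteq> {?P\<^sub>1, ?P\<^sub>2}"
  proof
    fix P assume "P \<in> proj_fiber std_cubic_scroll std_projection q"
    then obtain s t x y c where "c \<noteq> 0" and P: "P = proj_point (scroll_point s t x y)"
      and e: "-(t^2*y) = c * q$0" "t*x + s^2*y = c * q$1" "-(s*x) = c * q$2"
      by (rule proj_fiber_std_memE)
    from e(1) assms have "t = 0 \<or> y = 0" by simp
    then show "P \<in> {?P\<^sub>1, ?P\<^sub>2}"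
    proof
      assume "t = 0"
      then have "scroll_point s t x y = c *s scroll_point 1 0 (-q$2) (q$1)"
        using e by (simp add: vec_eq_5_iff) algebra
      then show ?thesis unfolding P by (simp add: proj_point_smult[OF \<open>c \<noteq> 0\<close>])
    next
      assume "y = 0"
      then have "scroll_point s t x y = c *s scroll_point (-q$2) (q$1) 1 0"
        using e by (simp add: vec_eq_5_iff) algebra
      then show ?thesis unfolding P by (simp add: proj_point_smult[OF \<open>c \<noteq> 0\<close>])
    qed
  qed
  then have "card (proj_fiber std_cubic_scroll std_projection q) \<le> card {?P\<^sub>1, ?P\<^sub>2}"
    by (rule card_mono[rotated]) simp
  also have "\<dots> \<le> 2" by (simp add: card_insert_if)
  finally show ?thesis .
qed

lemma card_proj_fiber_std_less_3_iff:
  assumes "q \<noteq> 0"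
  shows "card (proj_fiber std_cubic_scroll std_projection q) < 3 \<longleftrightarrow>
    q$0 * (4*(q$1)^3 + 27*q$0*(q$2)^2) = 0"
proof (cases "q$0 = 0")
  case True
  then show ?thesis using card_proj_fiber_std_le_2 by fastforce
next
  case False
  have "inj (\<lambda>z. proj_point (scroll_point z 1 (q$1 + z^2*q$0) (-q$0)))"
  proof (rule injI)
    fix z z'
    assume "proj_point (scroll_point z 1 (q$1 + z^2*q$0) (-q$0)) =
      proj_point (scroll_point z' 1 (q$1 + z'^2*q$0) (-q$0))"
    then obtain k where k: "scroll_point z 1 (q$1 + z^2*q$0) (-q$0) =
        k *s scroll_point z' 1 (q$1 + z'^2*q$0) (-q$0)"
      using proj_point_eq_imp_smult by blast
    then have "k = 1" using False by (simp add: vec_eq_5_iff)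
    with k show "z = z'" using False by (simp add: vec_eq_5_iff)
  qed
  then have "card (proj_fiber std_cubic_scroll std_projection q) = card {z. q$0*z^3 + q$1*z + q$2 = 0}"
    unfolding proj_fiber_std_eq_cubic_roots[OF False] by (simp add: card_image inj_on_subset)
  also have "\<dots> < 3 \<longleftrightarrow> 4*(q$1)^3 + 27*q$0*(q$2)^2 = 0"
    by (rule card_cubic_roots_less_3_iff[OF False])
  finally show ?thesis using False by simp
qed

definition cusp_coordinates :: "complex^3^3" where
  "cusp_coordinates = (\<chi> i j. if i = 0 \<and> j = 1 then -1 else if i = 1 \<and> j = 2 then 3
     else if i = 2 \<and> j = 0 then 3/4 else 0)"

lemma cusp_coordinates_nth:
  "(cusp_coordinates *v q) $ 0 = - q$1" "(cusp_coordinates *v q) $ 1 = 3 * q$2"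
  "(cusp_coordinates *v q) $ 2 = 3/4 * q$0"
  by (simp_all add: cusp_coordinates_def matrix_vector_mult_def sum_UNIV_3)

lemma invertible_cusp_coordinates: "invertible cusp_coordinates"
proof -
  let ?N' = "\<chi> i j. if i = 0 \<and> j = 2 then 4/3 else if i = 1 \<and> j = 0 then -1
     else if i = 2 \<and> j = 1 then 1/3 else (0 :: complex)"
  have "cusp_coordinates ** ?N' = mat 1"
    by (simp add: vec_eq_3_iff cusp_coordinates_def matrix_matrix_mult_def mat_def sum_UNIV_3)
  then show ?thesis unfolding invertible_right_inverse by blast
qed

lemma branch_locus_std_cubic_scroll:
  "branch_locus std_cubic_scroll std_projection =
     {q. cusp_coordinates *v q \<in> cusp_cubic_and_flex_tangent}"
proof (intro set_eqI)
  fix q :: "complex^3"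
  have "cusp_coordinates *v q \<noteq> 0 \<longleftrightarrow> q \<noteq> 0"
    by (auto simp: vec_eq_3_iff cusp_coordinates_nth)
  moreover have "(((cusp_coordinates *v q) $ 1)^2 * (cusp_coordinates *v q) $ 2
      - ((cusp_coordinates *v q) $ 0)^3) * (cusp_coordinates *v q) $ 2
      = 3/16 * (q$0 * (4*(q$1)^3 + 27*q$0*(q$2)^2))"
    by (simp add: cusp_coordinates_nth field_simps power2_eq_square power3_eq_cube)
  ultimately show "q \<in> branch_locus std_cubic_scroll std_projection \<longleftrightarrow>
      q \<in> {q. cusp_coordinates *v q \<in> cusp_cubic_and_flex_tangent}"
    unfolding branch_locus_def cusp_cubic_and_flex_tangent_def
    using card_proj_fiber_std_less_3_iff by auto
qed

lemma has_cusp_flex_branch_projection_std: "has_cusp_flex_branch_projection std_cubic_scroll"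
  unfolding has_cusp_flex_branch_projection_def
proof (intro exI conjI)
  show "{v. std_projection *v v = 0} \<inter> std_cubic_scroll = {}"
    using std_projection_nonzero by blast
qed (use proj_line_std_center invertible_cusp_coordinates branch_locus_std_cubic_scroll in auto)

theorem proposition5p2:
  fixes S :: "(complex^5) set"
  assumes "rational_normal_cubic_scroll S"
  shows "\<exists>L. proj_line L \<and> L \<inter> S = {} \<and>
           (\<exists>A :: complex^5^3. {v. A *v v = 0} = L \<and>
              (\<exists>N :: complex^3^3. invertible N \<and>
                 branch_locus S A = {q. N *v q \<in> cusp_cubic_and_flex_tangent}))"
proof -
  obtain M :: "complex^5^5" where "invertible M" and "S = (*v) M ` std_cubic_scroll"
    using assms unfolding rational_normal_cubic_scroll_def by blast
  then have "has_cusp_flex_branch_projection S"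
    using has_cusp_flex_branch_projection_image has_cusp_flex_branch_projection_std by blast
  then show ?thesis unfolding has_cusp_flex_branch_projection_def .
qed

end
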